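(* Let $N\ge 1$ and $n=N+1$. To generate, via the convex hull, the allowed region of fidelities for $1\to N$ universal qubit cloning it suffices to consider pure states with real coefficients; that is, $$\operatorname{conv}\Big(\bigcup_{\lambda}\mathcal{F}^{\lambda}\Big)=\operatorname{conv}\Big(\bigcup_{\lambda}\mathcal{F}^{\lambda}_{\mathbb{R}}\Big),$$ where the unions run over all partitions $\lambda$ of $n$ with at most two nonzero parts, $$\mathcal{F}^{\lambda}=\Big\{\Big(\tfrac12-\tfrac12\langle\psi|\widetilde{V}^{\lambda}_{(1k)}|\psi\rangle\Big)_{k=2}^{n} : |\psi\rangle\in\mathbb{C}^{d_\lambda},\ \langle\psi|\psi\rangle=1\Big\},$$ and $\mathcal{F}^{\lambda}_{\mathbb{R}}$ is the subset of $\mathcal{F}^\lambda$ obtained by restricting to unit vectors $|\psi\rangle\in\mathbb{R}^{d_\lambda}$.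
   Context: For a partition $\lambda$ of $n$, $\widetilde{V}^{\lambda}$ denotes the irreducible representation of $S_n$ labelled by $\lambda$, of dimension $d_\lambda$, written in the standard real orthogonal form (Young's orthogonal form), so that each $\widetilde{V}^{\lambda}_{\pi}$ is a real orthogonal matrix and, in particular, each transposition is represented by a real symmetric matrix. $(1k)\in S_n$ is the transposition exchanging $1$ and $k$. "Real coefficients" refers to the coordinates of $|\psi\rangle$ in this basis. $\operatorname{conv}(\bigcup_\lambda\mathcal{F}^\lambda)$ is the allowed region of fidelity vectors $(F_{12},\ldots,F_{1n})$ for universal $1\to N$ qubit cloning machines. *)

theory Defs
  imports "HOL-Analysis.Analysis" "HOL-Analysis.Finite_Function_Topology"
    "HOL-Combinatorics.Permutations"
begin

definition is_partition :: "nat \<Rightarrow> nat list \<Rightarrow> bool" where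
  "is_partition n \<mu> \<longleftrightarrow> sorted_wrt (\<ge>) \<mu> \<and> (\<forall>p\<in>set \<mu>. p > 0) \<and> sum_list \<mu> = n"

text \<open>
  A tableau is the list of its rows, top row first, so that \<open>T ! i ! j\<close> is the entry in
  row \<open>i\<close> and column \<open>j\<close> (both counted from 0).
\<close>

type_synonym tableau = "nat list list"

definition standard_tableaux :: "nat list \<Rightarrow> tableau set" where
  "standard_tableaux \<mu> = {T. map length T = \<mu> \<and>
     distinct (concat T) \<and> set (concat T) = {1..sum_list \<mu>} \<and>
     (\<forall>r\<in>set T. sorted_wrt (<) r) \<and>
     (\<forall>i j. Suc i < length T \<longrightarrow> j < length (T ! Suc i) \<longrightarrow> T ! i ! j < T ! Suc i ! j)}"

definition content :: "tableau \<Rightarrow> nat \<Rightarrow> int" where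
  "content T k = (THE c. \<exists>i j. i < length T \<and> j < length (T ! i) \<and> T ! i ! j = k \<and> c = int j - int i)"

definition axial_distance :: "tableau \<Rightarrow> nat \<Rightarrow> int" where
  "axial_distance T k = content T (Suc k) - content T k"

definition swap_entries :: "nat \<Rightarrow> tableau \<Rightarrow> tableau" where
  "swap_entries k T = map (map (Transposition.transpose k (Suc k))) T"

text \<open>
  The coordinates of \<open>\<complex>\<^sup>d\<close>, where \<open>d\<close> is the number of standard tableaux of shape \<open>\<mu>\<close>, are
  indexed by these tableaux. Matrices and vectors are functions of which only the
  values at standard tableaux of shape \<open>\<mu>\<close> are ever used.
\<close>

type_synonym matrix = "tableau \<Rightarrow> tableau \<Rightarrow> real"

definition mat_one :: matrix where
  "mat_one S T = (if S = T then 1 else 0)"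

definition mat_times :: "nat list \<Rightarrow> matrix \<Rightarrow> matrix \<Rightarrow> matrix" where
  "mat_times \<mu> A B = (\<lambda>S T. \<Sum>U\<in>standard_tableaux \<mu>. A S U * B U T)"

text \<open>
  Young's orthogonal form of the adjacent transposition \<open>(k k+1)\<close>: with \<open>r\<close> the axial
  distance, it sends the basis vector of \<open>T\<close> to \<open>1/r\<close> times itself plus \<open>sqrt (1 - 1/r^2)\<close> times
  the basis vector of \<open>T\<close> with \<open>k\<close> and \<open>k+1\<close> exchanged. If the exchanged tableau is not
  standard, then \<open>r = 1\<close> or \<open>r = -1\<close> and the second term vanishes.
\<close>

definition young_adjacent :: "nat \<Rightarrow> matrix" where
  "young_adjacent k S T =
     (if S = T then 1 / of_int (axial_distance T k)
      else if S = swap_entries k T then sqrt (1 - 1 / (of_int (axial_distance T k))\<^sup>2)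
      else 0)"

text \<open>
  A word \<open>[k\<^sub>1, \<dots>, k\<^sub>m]\<close> stands for the product of the adjacent transpositions
  \<open>(k\<^sub>i k\<^sub>i+1)\<close>. \<open>adjacent_word n \<pi>\<close> is a factorisation of a permutation \<open>\<pi>\<close> of \<open>{1..n}\<close>:
  with \<open>k = \<pi> n\<close>, the factors \<open>k, \<dots>, n-1\<close> are split off on the left (their product maps
  \<open>n\<close> to \<open>k\<close>), and the remaining permutation fixes \<open>n\<close>.
\<close>

definition perm_of_word :: "nat list \<Rightarrow> nat \<Rightarrow> nat" where
  "perm_of_word ks = foldr (\<lambda>k \<sigma>. Transposition.transpose k (Suc k) \<circ> \<sigma>) ks id"

fun adjacent_word :: "nat \<Rightarrow> (nat \<Rightarrow> nat) \<Rightarrow> nat list" where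
  "adjacent_word 0 \<pi> = []"
| "adjacent_word (Suc m) \<pi> =
     (let ks = [\<pi> (Suc m)..<Suc m] in ks @ adjacent_word m (perm_of_word (rev ks) \<circ> \<pi>))"

text \<open>
  Young's orthogonal form of an arbitrary permutation. The matrices of the adjacent
  transpositions satisfy the Coxeter relations, so the product does not depend on the
  chosen factorisation.
\<close>

definition young_orthogonal :: "nat list \<Rightarrow> (nat \<Rightarrow> nat) \<Rightarrow> matrix" where
  "young_orthogonal \<mu> \<pi> =
     foldr (\<lambda>k. mat_times \<mu> (young_adjacent k)) (adjacent_word (sum_list \<mu>) \<pi>) mat_one"

definition unit_vectors :: "nat list \<Rightarrow> (tableau \<Rightarrow> complex) set" where
  "unit_vectors \<mu> = {\<psi>. (\<Sum>T\<in>standard_tableaux \<mu>. cnj (\<psi> T) * \<psi> T) = 1}"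

definition real_unit_vectors :: "nat list \<Rightarrow> (tableau \<Rightarrow> complex) set" where
  "real_unit_vectors \<mu> = {\<psi> \<in> unit_vectors \<mu>. \<forall>T\<in>standard_tableaux \<mu>. \<psi> T \<in> \<real>}"

definition expectation :: "nat list \<Rightarrow> matrix \<Rightarrow> (tableau \<Rightarrow> complex) \<Rightarrow> complex" where
  "expectation \<mu> A \<psi> =
     (\<Sum>S\<in>standard_tableaux \<mu>. \<Sum>T\<in>standard_tableaux \<mu>. cnj (\<psi> S) * complex_of_real (A S T) * \<psi> T)"

text \<open>
  A vector \<open>(F\<^sub>k)\<close> with \<open>2 \<le> k \<le> n\<close> is represented by the finitely supported function
  with these values at \<open>2, \<dots>, n\<close> and 0 elsewhere. The matrices of transpositions are real
  symmetric, so \<open>Re\<close> only converts a real number from type \<open>complex\<close> to type \<open>real\<close>.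
\<close>

definition fidelity_vector :: "nat list \<Rightarrow> (tableau \<Rightarrow> complex) \<Rightarrow> (nat \<Rightarrow>\<^sub>0 real)" where
  "fidelity_vector \<mu> \<psi> = (\<Sum>k=2..sum_list \<mu>. Poly_Mapping.single k
     (1/2 - 1/2 * Re (expectation \<mu> (young_orthogonal \<mu> (Transposition.transpose 1 k)) \<psi>)))"

definition fidelity_set :: "nat list \<Rightarrow> (nat \<Rightarrow>\<^sub>0 real) set" where
  "fidelity_set \<mu> = fidelity_vector \<mu> ` unit_vectors \<mu>"

definition real_fidelity_set :: "nat list \<Rightarrow> (nat \<Rightarrow>\<^sub>0 real) set" where
  "real_fidelity_set \<mu> = fidelity_vector \<mu> ` real_unit_vectors \<mu>"

lemma perm_of_word_Nil [simp]: "perm_of_word [] = id"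
  by (simp add: perm_of_word_def)

lemma perm_of_word_Cons [simp]: "perm_of_word (k # ks) = Transposition.transpose k (Suc k) \<circ> perm_of_word ks"
  by (simp add: perm_of_word_def)

lemma perm_of_word_append: "perm_of_word (ks @ ls) = perm_of_word ks \<circ> perm_of_word ls"
  by (induction ks) (simp_all add: o_assoc)

lemma perm_of_word_rev: "perm_of_word ks (perm_of_word (rev ks) x) = x"
  by (induction ks arbitrary: x) (simp_all add: perm_of_word_append)

lemma perm_of_word_permutes: "set ks \<subseteq> {1..<n} \<Longrightarrow> perm_of_word ks permutes {1..n}"
proof (induction ks)
  case Nil
  then show ?case
    by (simp only: perm_of_word_Nil permutes_id)
next
  case (Cons k ks)
  then show ?case
    by (simp only: perm_of_word_Cons, intro permutes_compose permutes_swap_id) auto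
qed

lemma perm_of_word_upt: "k \<le> n \<Longrightarrow> perm_of_word [k..<n] n = k"
proof (induction k rule: inc_induct)
  case base
  show ?case by simp
next
  case (step k)
  then show ?case
    by (simp add: upt_conv_Cons)
qed

text \<open>\<open>adjacent_word\<close> is indeed a factorisation into adjacent transpositions.\<close>

lemma adjacent_word_correct:
  assumes "\<pi> permutes {1..n}"
  shows "set (adjacent_word n \<pi>) \<subseteq> {1..<n} \<and> perm_of_word (adjacent_word n \<pi>) = \<pi>"
  using assms
proof (induction n arbitrary: \<pi>)
  case 0
  then show ?case by (simp add: id_def)
next
  case (Suc m)
  define ks where "ks = [\<pi> (Suc m)..<Suc m]"
  define \<sigma> where "\<sigma> = perm_of_word (rev ks) \<circ> \<pi>"
  have k: "\<pi> (Suc m) \<in> {1..Suc m}"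
    using permutes_in_image[OF Suc.prems, of "Suc m"] by simp
  then have ks: "set ks \<subseteq> {1..<Suc m}"
    by (auto simp: ks_def)
  have per: "\<sigma> permutes {1..Suc m}"
    unfolding \<sigma>_def using Suc.prems ks by (intro permutes_compose perm_of_word_permutes) auto
  have "\<sigma> (Suc m) = perm_of_word (rev ks) (perm_of_word ks (Suc m))"
    using k by (simp add: \<sigma>_def ks_def perm_of_word_upt del: upt_Suc)
  also have "\<dots> = Suc m"
    using perm_of_word_rev[of "rev ks"] by simp
  finally have fix_m: "\<sigma> (Suc m) = Suc m" .
  have "\<sigma> permutes {1..m}"
    by (rule permutes_superset[OF per]) (use fix_m in \<open>auto simp: le_Suc_eq\<close>)
  note IH = Suc.IH[OF this]
  have word: "adjacent_word (Suc m) \<pi> = ks @ adjacent_word m \<sigma>"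
    by (simp add: ks_def \<sigma>_def Let_def del: upt_Suc)
  have "perm_of_word (ks @ adjacent_word m \<sigma>) = perm_of_word ks \<circ> \<sigma>"
    using IH by (simp only: perm_of_word_append)
  also have "\<dots> = \<pi>"
    by (simp add: \<sigma>_def fun_eq_iff perm_of_word_rev)
  finally have "perm_of_word (ks @ adjacent_word m \<sigma>) = \<pi>" .
  moreover have "set (ks @ adjacent_word m \<sigma>) \<subseteq> {1..<Suc m}"
    using ks IH by fastforce
  ultimately show ?case
    unfolding word by blast
qed

end

theory Submission
  imports Defs
begin

text \<open>
  For a real matrix \<open>A\<close> and \<open>\<psi> = a + \<i>b\<close> with real \<open>a\<close>, \<open>b\<close>, the cross terms of
  \<open>\<langle>\<psi>|A|\<psi>\<rangle>\<close> are purely imaginary, so the real part is \<open>\<langle>a|A|a\<rangle> + \<langle>b|A|b\<rangle>\<close>. Since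
  \<open>\<langle>a|a\<rangle> + \<langle>b|b\<rangle> = 1\<close>, the fidelity vector of \<open>\<psi>\<close> is the convex combination, with these
  weights, of the fidelity vectors of the normalisations of \<open>a\<close> and \<open>b\<close>.
\<close>

lemma Re_expectation_split:
  "Re (expectation \<mu> A \<psi>) =
     Re (expectation \<mu> A (\<lambda>T. complex_of_real (Re (\<psi> T)))) +
     Re (expectation \<mu> A (\<lambda>T. complex_of_real (Im (\<psi> T))))"
  by (simp add: expectation_def sum.distrib[symmetric] algebra_simps)

lemma real_unit_vectors_of_real_iff:
  "(\<lambda>T. complex_of_real (a T)) \<in> real_unit_vectors \<mu> \<longleftrightarrow>
     (\<Sum>T\<in>standard_tableaux \<mu>. (a T)\<^sup>2) = 1"
proof -
  have "(\<Sum>T\<in>standard_tableaux \<mu>. cnj (complex_of_real (a T)) * complex_of_real (a T)) =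
      complex_of_real (\<Sum>T\<in>standard_tableaux \<mu>. (a T)\<^sup>2)"
    by (simp add: power2_eq_square)
  then show ?thesis
    by (simp add: real_unit_vectors_def unit_vectors_def del: of_real_sum)
qed

text \<open>The expectation is quadratic, so passing from \<open>a\<close> to its normalisation
  costs exactly the factor of the squared norm. The vector \<open>u\<close> is fixed before
  \<open>A\<close>: a single unit vector has to serve for all coordinates of the fidelity vector at
  once.\<close>

lemma exists_normalisation:
  assumes "finite (standard_tableaux \<mu>)" and "standard_tableaux \<mu> \<noteq> {}"
  obtains u where "u \<in> real_unit_vectors \<mu>"
    and "\<And>A. Re (expectation \<mu> A (\<lambda>T. complex_of_real (a T))) =
           (\<Sum>T\<in>standard_tableaux \<mu>. (a T)\<^sup>2) * Re (expectation \<mu> A u)"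
proof (cases "(\<Sum>T\<in>standard_tableaux \<mu>. (a T)\<^sup>2) = 0")
  case True
  then have "a T = 0" if "T \<in> standard_tableaux \<mu>" for T
    using assms(1) that by (simp add: sum_nonneg_eq_0_iff)
  then have zero: "expectation \<mu> A (\<lambda>T. complex_of_real (a T)) = 0" for A
    by (simp add: expectation_def)
  \<comment> \<open>The zero vector has no normalisation, but its weight is 0, so any real unit
    vector will do; the basis vector at \<open>T\<^sub>0\<close> is taken.\<close>
  obtain T\<^sub>0 where "T\<^sub>0 \<in> standard_tableaux \<mu>"
    using assms(2) by blast
  then have "(\<Sum>T\<in>standard_tableaux \<mu>. (if T = T\<^sub>0 then 1 else 0 :: real)\<^sup>2) = 1"
    using assms(1) by (simp add: if_distrib[where f = "\<lambda>x. x\<^sup>2"] cong: if_cong)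
  then show ?thesis
    using that[OF iffD2[OF real_unit_vectors_of_real_iff]] zero True by simp
next
  case False
  define s where "s = (\<Sum>T\<in>standard_tableaux \<mu>. (a T)\<^sup>2)"
  have s: "s > 0"
    using False by (simp add: s_def less_le sum_nonneg)
  define u where "u T = a T / sqrt s" for T
  have "(\<Sum>T\<in>standard_tableaux \<mu>. (u T)\<^sup>2) = 1"
    using s by (simp add: u_def power_divide sum_divide_distrib[symmetric] s_def[symmetric])
  moreover have scaled: "a S * A S T * a T = s * (u S * A S T * u T)" for A :: matrix and S T
    using s by (simp add: u_def field_simps)
  have "Re (expectation \<mu> A (\<lambda>T. complex_of_real (a T))) =
      s * Re (expectation \<mu> A (\<lambda>T. complex_of_real (u T)))" for A
    by (simp add: expectation_def sum_distrib_left scaled)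
  ultimately show ?thesis
    using that[OF iffD2[OF real_unit_vectors_of_real_iff]] by (simp add: s_def)
qed

lemma lookup_scaleR:
  "Poly_Mapping.lookup (c *\<^sub>R f) k = c *\<^sub>R Poly_Mapping.lookup f k"
  for f :: "'a \<Rightarrow>\<^sub>0 'b::real_vector"
proof -
  have "finite {i. c *\<^sub>R Poly_Mapping.lookup f i \<noteq> 0}"
    by (rule finite_subset[OF _ finite_lookup[of f]]) auto
  then show ?thesis
    by (simp add: scaleR_poly_mapping_def)
qed

text \<open>Each coordinate is an affine function of an expectation, and \<open>s + t = 1\<close>
  lets the constant 1/2 be distributed over the two terms.\<close>

lemma fidelity_vector_convex_combination:
  assumes "s + t = 1"
    and "\<And>A. Re (expectation \<mu> A \<psi>) = s * Re (expectation \<mu> A u) + t * Re (expectation \<mu> A v)"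
  shows "fidelity_vector \<mu> \<psi> = s *\<^sub>R fidelity_vector \<mu> u + t *\<^sub>R fidelity_vector \<mu> v"
proof -
  have "1/2 - 1/2 * (s * x + t * y) = s * (1/2 - 1/2 * x) + t * (1/2 - 1/2 * y)" for x y
    using assms(1) by algebra
  then show ?thesis
    unfolding fidelity_vector_def assms(2)
    by (intro poly_mapping_eqI)
       (simp add: lookup_sum lookup_add lookup_single lookup_scaleR when_def sum_distrib_left
         sum.distrib[symmetric] if_distrib cong: if_cong)
qed

text \<open>The real and imaginary parts of \<open>\<psi>\<close> lie in the same representation as
  \<open>\<psi>\<close>, so the convex combination is formed within a single shape.\<close>

lemma fidelity_set_subset: "fidelity_set \<mu> \<subseteq> convex hull (real_fidelity_set \<mu>)"
proof
  fix x
  assume "x \<in> fidelity_set \<mu>"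
  then obtain \<psi> where x: "x = fidelity_vector \<mu> \<psi>"
    and \<psi>: "(\<Sum>T\<in>standard_tableaux \<mu>. cnj (\<psi> T) * \<psi> T) = 1"
    by (auto simp: fidelity_set_def unit_vectors_def)
  \<comment> \<open>A sum over an infinite or an empty set is 0 by convention, so its being 1
    excludes both.\<close>
  have "finite (standard_tableaux \<mu>)" "standard_tableaux \<mu> \<noteq> {}"
    using \<psi> by (auto intro: ccontr)
  note norm = exists_normalisation[OF this]
  define s t where "s = (\<Sum>T\<in>standard_tableaux \<mu>. (Re (\<psi> T))\<^sup>2)"
    and "t = (\<Sum>T\<in>standard_tableaux \<mu>. (Im (\<psi> T))\<^sup>2)"
  obtain u where u: "u \<in> real_unit_vectors \<mu>"
    "\<And>A. Re (expectation \<mu> A (\<lambda>T. complex_of_real (Re (\<psi> T)))) = s * Re (expectation \<mu> A u)"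
    using norm[of "\<lambda>T. Re (\<psi> T)"] unfolding s_def by blast
  obtain v where v: "v \<in> real_unit_vectors \<mu>"
    "\<And>A. Re (expectation \<mu> A (\<lambda>T. complex_of_real (Im (\<psi> T)))) = t * Re (expectation \<mu> A v)"
    using norm[of "\<lambda>T. Im (\<psi> T)"] unfolding t_def by blast
  \<comment> \<open>The weights are the squared norms of the two parts, which add up to the squared
    norm of \<open>\<psi>\<close>.\<close>
  have "s + t = Re (\<Sum>T\<in>standard_tableaux \<mu>. cnj (\<psi> T) * \<psi> T)"
    by (simp add: s_def t_def power2_eq_square sum.distrib)
  then have st: "s + t = 1"
    by (simp add: \<psi>)
  have "x = s *\<^sub>R fidelity_vector \<mu> u + t *\<^sub>R fidelity_vector \<mu> v"
    unfolding x using st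
    by (rule fidelity_vector_convex_combination) (simp add: Re_expectation_split[of _ _ \<psi>] u v)
  moreover have "s \<ge> 0" "t \<ge> 0"
    by (simp_all add: s_def t_def sum_nonneg)
  moreover have "fidelity_vector \<mu> u \<in> convex hull (real_fidelity_set \<mu>)"
    "fidelity_vector \<mu> v \<in> convex hull (real_fidelity_set \<mu>)"
    using u v by (auto simp: real_fidelity_set_def intro: hull_inc)
  ultimately show "x \<in> convex hull (real_fidelity_set \<mu>)"
    using st by (simp add: convexD[OF convex_convex_hull])
qed

theorem lemma3:
  fixes N n :: nat
  assumes "N \<ge> 1" and "n = N + 1"
  shows "convex hull (\<Union>\<mu>\<in>{\<mu>. is_partition n \<mu> \<and> length \<mu> \<le> 2}. fidelity_set \<mu>) =
         convex hull (\<Union>\<mu>\<in>{\<mu>. is_partition n \<mu> \<and> length \<mu> \<le> 2}. real_fidelity_set \<mu>)"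
    (is "convex hull (\<Union>\<mu>\<in>?P. fidelity_set \<mu>) = convex hull ?R")
proof (rule antisym)
  \<comment> \<open>The inclusion for one shape passes to the union because the hull is
    monotone.\<close>
  have "fidelity_set \<mu> \<subseteq> convex hull ?R" if "\<mu> \<in> ?P" for \<mu>
    using fidelity_set_subset hull_mono[of "real_fidelity_set \<mu>" ?R convex] that by blast
  then show "convex hull (\<Union>\<mu>\<in>?P. fidelity_set \<mu>) \<subseteq> convex hull ?R"
    by (intro hull_minimal convex_convex_hull) blast
  have "real_fidelity_set \<mu> \<subseteq> fidelity_set \<mu>" for \<mu>
    by (auto simp: real_fidelity_set_def fidelity_set_def real_unit_vectors_def)
  then show "convex hull ?R \<subseteq> convex hull (\<Union>\<mu>\<in>?P. fidelity_set \<mu>)"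
    by (intro hull_mono UN_mono) auto
qed

end
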